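(* Let $K\in\{3,\dots,n-3\}$, let $b=3$, and let $a,c,d$ be distinct vertices of $V\setminus\{3\}$. The inequality $$x_{a,b}+x_{b,c}-x_{a,c}+x_{c,d}+x_c+x_{1,2}-\sum_{i=4}^n x_i\le 4-K$$ (which corresponds to the paw inequality $x_{a,b}+x_{b,c}-x_{a,c}+x_{c,d}+x_b+x_c\le 2$ for $b=3$, after substituting $x_3=K-2+x_{1,2}-\sum_{i=4}^n x_i$) is facet-defining for $P_{n,K}$ if and only if (1) $d<3<c$; and (2) $a<3$.
   Context: $V=\{1,\dots,n\}$ and $E$ is the set of all unordered pairs $ij$ of distinct elements of $V$; $x_{i,j}=x_{j,i}$. A $K$-partition $\pi$ is a collection of $K$ non-empty pairwise disjoint subsets (clusters) of $V$ whose union is $V$. The representative of a cluster is its smallest element. The characteristic vector $x^\pi\in\{0,1\}^{|E|+|V|-3}$ of $\pi$ has components $x_4,\dots,x_n$ and $x_{i,j}$ for $ij\in E$, where $x^\pi_{i,j}=1$ if $i,j$ are in the same cluster and $0$ otherwise, and $x^\pi_u=1$ if $u$ is the representative of its cluster and $0$ otherwise. Representative variables of vertices $1,2,3$ are not coordinates; whenever written they stand for $x_1=1$, $x_2=1-x_{1,2}$, $x_3=K-2+x_{1,2}-\sum_{i=4}^n x_i$ (which on $x^\pi$ equal $1$ if the vertex is a representative and $0$ otherwise). $P_{n,K}\subset\mathbb R^{|E|+|V|-3}$ is the convex hull of the characteristic vectors $x^\pi$ of all $K$-partitions $\pi$ of $V$ (equivalently, of all $0/1$ solutions of the integer formulation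 of the $K$-partitioning problem). It is full-dimensional (dimension $|E|+|V|-3$) if and only if $K\in\{3,\dots,n-2\}$. An inequality is facet-defining for $P_{n,K}$ if it is valid for $P_{n,K}$ and the set of points of $P_{n,K}$ satisfying it with equality has dimension $\dim(P_{n,K})-1$. *)

theory Defs
  imports "HOL-Analysis.Analysis" "HOL-Analysis.Finite_Function_Topology" "HOL-Library.Disjoint_Sets"
begin

text \<open>
  The coordinates of the ambient space: the edge variables \<open>x\<^sub>i\<^sub>,\<^sub>j\<close>, labelled by the unordered
  pair, and the representative variables \<open>x\<^sub>4, \<dots>, x\<^sub>n\<close>.  The real space with coordinate set \<open>coords n\<close> sits
  inside the finitely supported functions \<open>coord \<Rightarrow>\<^sub>0 real\<close> as the subspace of those functions
  that vanish outside \<open>coords n\<close>, so that the number \<open>n\<close> need not be encoded as a type.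
\<close>

datatype coord = Edge "nat set" | Rep nat

definition coords :: "nat \<Rightarrow> coord set" where
  "coords n = {Edge {i, j} | i j. i \<in> {1..n} \<and> j \<in> {1..n} \<and> i \<noteq> j} \<union> Rep ` {4..n}"

abbreviation edge_var :: "(coord \<Rightarrow>\<^sub>0 real) \<Rightarrow> nat \<Rightarrow> nat \<Rightarrow> real" where
  "edge_var x i j \<equiv> Poly_Mapping.lookup x (Edge {i, j})"

definition rep_var :: "nat \<Rightarrow> nat \<Rightarrow> (coord \<Rightarrow>\<^sub>0 real) \<Rightarrow> nat \<Rightarrow> real" where
  "rep_var n K x u =
    (if u = 1 then 1
     else if u = 2 then 1 - edge_var x 1 2
     else if u = 3 then real K - 2 + edge_var x 1 2 - (\<Sum>i=4..n. Poly_Mapping.lookup x (Rep i))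
     else Poly_Mapping.lookup x (Rep u))"

definition k_partition :: "nat \<Rightarrow> nat \<Rightarrow> nat set set \<Rightarrow> bool" where
  "k_partition n K \<pi> \<longleftrightarrow> partition_on {1..n} \<pi> \<and> card \<pi> = K"

fun char_coord :: "nat set set \<Rightarrow> coord \<Rightarrow> real" where
  "char_coord \<pi> (Edge e) = of_bool (\<exists>C\<in>\<pi>. e \<subseteq> C)"
| "char_coord \<pi> (Rep u) = of_bool (\<exists>C\<in>\<pi>. u = Min C)"

definition char_vec :: "nat \<Rightarrow> nat set set \<Rightarrow> coord \<Rightarrow>\<^sub>0 real" where
  "char_vec n \<pi> = (\<Sum>k\<in>coords n. Poly_Mapping.single k (char_coord \<pi> k))"

definition partition_polytope :: "nat \<Rightarrow> nat \<Rightarrow> (coord \<Rightarrow>\<^sub>0 real) set" where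
  "partition_polytope n K = convex hull (char_vec n ` {\<pi>. k_partition n K \<pi>})"

text \<open>
  The library's \<open>aff_dim\<close> is restricted to the class \<open>euclidean_space\<close>.  The following is the
  same notion for arbitrary real vector spaces: the dimension of the linear space spanned by the
  differences, with \<open>-1\<close> for the empty set.
\<close>

definition affine_dim :: "'a::real_vector set \<Rightarrow> int" where
  "affine_dim S = (if S = {} then -1 else int (dim {x - y | x y. x \<in> S \<and> y \<in> S}))"

definition facet_defining :: "'a::real_vector set \<Rightarrow> ('a \<Rightarrow> real) \<Rightarrow> real \<Rightarrow> bool" where
  "facet_defining P f \<beta> \<longleftrightarrow>
     (\<forall>x\<in>P. f x \<le> \<beta>) \<and> affine_dim {x \<in> P. f x = \<beta>} = affine_dim P - 1"

lemma affine_dim_eq_aff_dim: "affine_dim S = aff_dim S" for S :: "'a::euclidean_space set"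
proof (cases "S = {}")
  case False
  then obtain a where a: "a \<in> S" by blast
  let ?D = "{x - y | x y. x \<in> S \<and> y \<in> S}" and ?T = "(+) (- a) ` S"
  have "?T \<subseteq> span ?D"
  proof
    fix z assume "z \<in> ?T"
    then obtain x where "z = x - a" "x \<in> S" by auto
    with a have "z \<in> ?D" by blast
    then show "z \<in> span ?D" by (rule span_base)
  qed
  moreover have "?D \<subseteq> span ?T"
  proof
    fix z assume "z \<in> ?D"
    then obtain x y where z: "z = x - y" and "x \<in> S" "y \<in> S" by blast
    then have "(- a + x) - (- a + y) \<in> span ?T"
      by (intro span_diff span_base imageI)
    then show "z \<in> span ?T"
      using z by simp
  qed
  ultimately have "dim ?D = dim ?T"
    by (intro antisym dim_mono)
  moreover have "aff_dim S = int (dim ?T)"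
    by (rule aff_dim_eq_dim) (rule hull_inc[OF a])
  ultimately show ?thesis
    using False unfolding affine_dim_def by (simp only: if_False)
qed (simp add: affine_dim_def)

lemma finite_coords: "finite (coords n)"
proof -
  have "{Edge {i, j} | i j. i \<in> {1..n} \<and> j \<in> {1..n} \<and> i \<noteq> j}
      \<subseteq> (\<lambda>(i, j). Edge {i, j}) ` ({1..n} \<times> {1..n})"
    by auto
  then show ?thesis
    unfolding coords_def
    by (simp add: finite_subset)
qed

lemma lookup_char_vec:
  "Poly_Mapping.lookup (char_vec n \<pi>) k = (if k \<in> coords n then char_coord \<pi> k else 0)"
proof -
  have "Poly_Mapping.lookup (char_vec n \<pi>) k
      = (\<Sum>j\<in>coords n. if j = k then char_coord \<pi> j else 0)"
    unfolding char_vec_def lookup_sum lookup_single when_def by (rule refl)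
  also have "\<dots> = (if k \<in> coords n then char_coord \<pi> k else 0)"
    by (simp only: sum.delta finite_coords)
  finally show ?thesis .
qed

end

theory Submission
  imports Defs
begin

text \<open>
  A partition is encoded by the map \<open>r\<close> sending each vertex to the representative of its cluster; on
  characteristic vectors the inequality becomes \<open>paw a c d r \<le> 2\<close>.  Outside the stated conditions it
  is not even valid, as a few explicit partitions show.  Under the conditions, \<open>{a, d} = {1, 2}\<close> and
  \<open>c \<ge> 4\<close>, and it suffices that every linear functional that is constant on the tight partitions is
  an affine function of \<open>paw\<close> on all partitions.  Moving a vertex \<open>u\<close> outside \<open>{1, 2, 3, c}\<close> between
  clusters of a tight partition never affects tightness, which forces all coefficients of edges at
  \<open>u\<close> to vanish; exchanging two such vertices makes their representative coefficients equal.  The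
  remaining coefficients live on \<open>{1, 2, 3, c}\<close> and are determined by nine tight partitions.
\<close>

section \<open>A criterion for facets\<close>

lemma convex_linear_level: "linear h \<Longrightarrow> convex {x. h x = (s::real)}"
  unfolding convex_def by (auto simp: linear_add linear_scale simp flip: distrib_right)

lemma convex_linear_sublevel:
  assumes "linear h" shows "convex {x. h x \<le> (s::real)}"
  unfolding convex_def
  by (auto simp: linear_add[OF assms] linear_scale[OF assms] intro!: convex_bound_le)

text \<open>If every functional constant on the tight points is affine in \<open>f\<close>, then the
  differences within the face, together with one direction \<open>w\<close> leaving it, must span
  all differences within the polytope.\<close>

lemma facet_defining_convex_hullI:
  fixes f :: "'a::real_vector \<Rightarrow> real"
  assumes fin: "finite V" and f: "linear f"
    and valid: "\<And>v. v \<in> V \<Longrightarrow> f v \<le> \<beta>"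
    and v0: "v0 \<in> V" "f v0 = \<beta>" and v1: "v1 \<in> V" "f v1 \<noteq> \<beta>"
    and key: "\<And>g :: 'a \<Rightarrow> real. linear g \<Longrightarrow>
      (\<And>x y. x \<in> V \<Longrightarrow> y \<in> V \<Longrightarrow> f x = \<beta> \<Longrightarrow> f y = \<beta> \<Longrightarrow> g x = g y) \<Longrightarrow>
      \<exists>t s. \<forall>v\<in>V. g v = t * f v + s"
  shows "facet_defining (convex hull V) f \<beta>"
proof -
  define P where "P = convex hull V"
  define F where "F = {x \<in> P. f x = \<beta>}"
  define DF where "DF = {x - y | x y. x \<in> F \<and> y \<in> F}"
  define DP where "DP = {x - y | x y. x \<in> P \<and> y \<in> P}"
  have VP: "V \<subseteq> P" unfolding P_def by (rule hull_subset)
  have le: "f x \<le> \<beta>" if "x \<in> P" for x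
  proof -
    have "P \<subseteq> {x. f x \<le> \<beta>}"
      unfolding P_def by (rule hull_minimal) (use valid convex_linear_sublevel[OF f] in auto)
    with that show ?thesis by blast
  qed
  have "F \<subseteq> P" by (auto simp: F_def)
  have "DF \<subseteq> DP" using \<open>F \<subseteq> P\<close> by (auto simp: DF_def DP_def)
  \<comment> \<open>The ambient space may have infinite dimension; the basis \<open>B\<close> is
    finite because \<open>V\<close> is.\<close>
  have "P \<subseteq> span V"
    unfolding P_def by (rule hull_minimal) (auto intro: span_base subspace_imp_convex)
  then have DPV: "DP \<subseteq> span V" by (auto simp: DP_def intro!: span_diff)
  obtain B where B: "B \<subseteq> DF" "independent B" "DF \<subseteq> span B"
    by (rule maximal_independent_subset)
  have finB: "finite B"
    using independent_span_bound[OF fin B(2)] B(1) \<open>DF \<subseteq> DP\<close> DPV by blast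
  have dimF: "dim DF = card B" using basis_card_eq_dim[OF B(1,3,2)] by simp
  define w where "w = v1 - v0"
  have fw: "f w \<noteq> 0" using v0 v1 by (simp add: w_def linear_diff[OF f])
  have fB: "f x = 0" if "x \<in> span B" for x
  proof (rule linear_eq_0_on_span[OF f _ that])
    show "f b = 0" if "b \<in> B" for b
      using that B(1) by (auto simp: DF_def F_def linear_diff[OF f])
  qed
  have wB: "w \<notin> span B" using fB fw by blast
  have ind: "independent (insert w B)" using wB B(2) by (simp add: independent_insert)
  have wDP: "insert w B \<subseteq> DP"
    using v0 v1 VP B(1) \<open>DF \<subseteq> DP\<close> by (auto simp: w_def DP_def)
  have "DP \<subseteq> span (insert w B)"
  proof (rule ccontr)
    assume "\<not> DP \<subseteq> span (insert w B)"
    then obtain z where z: "z \<in> DP" "z \<notin> span (insert w B)" by blast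
    have "independent (insert z (insert w B))"
      using z(2) ind by (simp add: independent_insert)
    \<comment> \<open>A second missing direction \<open>z\<close> would admit a functional that
      vanishes on \<open>B\<close> and \<open>w\<close> but not at \<open>z\<close>. By
      \<open>key\<close> it is a multiple of \<open>f\<close> on differences; since it is 0 at
      \<open>w\<close>, where \<open>f\<close> is not, the multiple is 0.\<close>
    from linear_independent_extend[OF this, of "\<lambda>x. if x = z then 1 else 0"]
    obtain g :: "'a \<Rightarrow> real" where g: "linear g"
      and gv: "\<forall>x\<in>insert z (insert w B). g x = (if x = z then 1 else 0)"
      by blast
    have zn: "z \<notin> insert w B" using z(2) span_base by blast
    have g0: "g x = 0" if "x \<in> span B" for x
      by (rule linear_eq_0_on_span[OF g _ that]) (use gv zn in auto)
    have gw: "g w = 0" using gv zn by auto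
    have gz: "g z = 1" using gv by auto
    have "g x = g y" if "x \<in> V" "y \<in> V" "f x = \<beta>" "f y = \<beta>" for x y
    proof -
      have "x - y \<in> DF" using that VP by (auto simp: DF_def F_def)
      with B(3) g0 have "g (x - y) = 0" by blast
      then show ?thesis by (simp add: linear_diff[OF g])
    qed
    from key[OF g this] obtain t s where ts: "\<forall>v\<in>V. g v = t * f v + s" by blast
    have lin: "linear (\<lambda>x. g x - t *\<^sub>R f x)"
      by (intro linear_compose_sub linear_compose_scale_right f g)
    have "P \<subseteq> {x. g x - t *\<^sub>R f x = s}"
      unfolding P_def by (rule hull_minimal) (use ts convex_linear_level[OF lin] in auto)
    then have level: "g x - t * f x = s" if "x \<in> P" for x
      using that by auto
    have gt: "g x = t * f x" if "x \<in> DP" for x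
    proof -
      obtain y z where "x = y - z" "y \<in> P" "z \<in> P" using \<open>x \<in> DP\<close> by (auto simp: DP_def)
      with level[of y] level[of z] show ?thesis
        by (simp add: linear_diff[OF g] linear_diff[OF f] right_diff_distrib)
    qed
    have "t = 0" using gt[of w] wDP gw fw by auto
    with gt[OF z(1)] gz show False by simp
  qed
  then have "dim DP = card (insert w B)"
    using basis_card_eq_dim[OF wDP _ ind] by simp
  also have "\<dots> = card B + 1" using finB wB span_base by (subst card_insert_disjoint) auto
  finally have "int (dim DF) = int (dim DP) - 1" using dimF by simp
  moreover have "F \<noteq> {}" "P \<noteq> {}" using v0 VP by (auto simp: F_def)
  ultimately have "affine_dim F = affine_dim P - 1"
    by (simp add: affine_dim_def DF_def DP_def)
  with le show ?thesis unfolding facet_defining_def P_def F_def by blast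
qed

section \<open>Partitions as representative maps\<close>

text \<open>Fixed points are the representatives and their fibres the clusters. The set
  \<open>X\<close> is arbitrary so that partitions of a few vertices can be given first and extended
  later.\<close>

definition is_rep_map :: "nat set \<Rightarrow> (nat \<Rightarrow> nat) \<Rightarrow> bool" where
  "is_rep_map X r \<longleftrightarrow> (\<forall>i\<in>X. r i \<in> X \<and> r i \<le> i \<and> r (r i) = r i)"

definition rep_maps :: "nat \<Rightarrow> nat \<Rightarrow> (nat \<Rightarrow> nat) set" where
  "rep_maps n K = {r. is_rep_map {1..n} r \<and> card {i \<in> {1..n}. r i = i} = K}"

lemma rep_mapsD:
  assumes "r \<in> rep_maps n K" "i \<in> {1..n}"
  shows "r i \<in> {1..n}" "r i \<le> i" "r (r i) = r i"
  using assms unfolding rep_maps_def is_rep_map_def by blast+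

lemma rep_maps_1: "r \<in> rep_maps n K \<Longrightarrow> 1 \<le> n \<Longrightarrow> r 1 = 1"
  using rep_mapsD[of r n K 1] by simp

lemma rep_maps_2: "r \<in> rep_maps n K \<Longrightarrow> 2 \<le> n \<Longrightarrow> r 2 = 1 \<or> r 2 = 2"
  using rep_mapsD[of r n K 2] by auto

fun map_coord :: "(nat \<Rightarrow> nat) \<Rightarrow> coord \<Rightarrow> real" where
  "map_coord r (Edge e) = of_bool (\<forall>i\<in>e. \<forall>j\<in>e. r i = r j)"
| "map_coord r (Rep u) = of_bool (r u = u)"

definition map_vec :: "nat \<Rightarrow> (nat \<Rightarrow> nat) \<Rightarrow> coord \<Rightarrow>\<^sub>0 real" where
  "map_vec n r = (\<Sum>k\<in>coords n. Poly_Mapping.single k (map_coord r k))"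

text \<open>A cluster contains its minimum, so by disjointness two clusters coincide exactly when
  their minima do.\<close>

lemma char_vec_eq_map_vec:
  assumes \<pi>: "partition_on {1..n} \<pi>"
    and r: "\<And>C i. C \<in> \<pi> \<Longrightarrow> i \<in> C \<Longrightarrow> r i = Min C"
  shows "char_vec n \<pi> = map_vec n r"
proof -
  have fin: "finite C" if "C \<in> \<pi>" for C
    using that \<pi> finite_subset[of C "{1..n}"] by (auto simp: partition_on_def)
  have mem: "Min C \<in> C" if "C \<in> \<pi>" for C
    using that \<pi> fin[OF that] by (auto simp: partition_on_def intro!: Min_in)
  have ex: "\<exists>C\<in>\<pi>. i \<in> C" if "i \<in> {1..n}" for i
    using that \<pi> by (auto simp: partition_on_def)
  have disj: "C = D" if "C \<in> \<pi>" "D \<in> \<pi>" "i \<in> C" "i \<in> D" for C D i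
    using that partition_onD2[OF \<pi>] by (metis IntI disjointD empty_iff)
  have "char_coord \<pi> k = map_coord r k" if "k \<in> coords n" for k
  proof -
    consider i j where "k = Edge {i, j}" "i \<in> {1..n}" "j \<in> {1..n}" | u where "k = Rep u" "u \<in> {1..n}"
      using \<open>k \<in> coords n\<close> by (force simp: coords_def)
    then show ?thesis
    proof cases
      case 1
      obtain C D where C: "C \<in> \<pi>" "i \<in> C" and D: "D \<in> \<pi>" "j \<in> D" using ex 1 by meson
      have "(\<exists>E\<in>\<pi>. {i, j} \<subseteq> E) \<longleftrightarrow> C = D"
        using C D disj by (metis empty_subsetI insert_subset)
      also have "\<dots> \<longleftrightarrow> Min C = Min D"
        using disj[OF C(1) D(1) mem[OF C(1)]] mem[OF D(1)] by auto
      finally have "(\<exists>E\<in>\<pi>. {i, j} \<subseteq> E) \<longleftrightarrow> Min C = Min D" .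
      moreover have "(\<forall>x\<in>{i, j}. \<forall>y\<in>{i, j}. r x = r y) \<longleftrightarrow> r i = r j" by auto
      ultimately show ?thesis
        unfolding 1 char_coord.simps map_coord.simps r[OF C] r[OF D] by (simp only:)
    next
      case 2
      have "(\<exists>C\<in>\<pi>. u = Min C) \<longleftrightarrow> r u = u"
        using ex[OF 2(2)] r mem by metis
      then show ?thesis using 2 by simp
    qed
  qed
  then show ?thesis by (simp add: char_vec_def map_vec_def)
qed

text \<open>One direction sends each vertex to the minimum of its cluster, the other takes the
  fibres over the fixed points. Clusters and fixed points correspond bijectively, so both number
  \<open>K\<close>.\<close>

lemma char_vec_image_eq_map_vec_image:
  "char_vec n ` {\<pi>. k_partition n K \<pi>} = map_vec n ` rep_maps n K"
proof (intro equalityI subsetI)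
  fix x assume "x \<in> char_vec n ` {\<pi>. k_partition n K \<pi>}"
  then obtain \<pi> where x: "x = char_vec n \<pi>" and \<pi>: "partition_on {1..n} \<pi>" and card: "card \<pi> = K"
    by (auto simp: k_partition_def)
  define r where "r i = Min (THE C. C \<in> \<pi> \<and> i \<in> C)" for i
  have disj: "C = D" if "C \<in> \<pi>" "D \<in> \<pi>" "i \<in> C" "i \<in> D" for C D i
    using that partition_onD2[OF \<pi>] by (metis IntI disjointD empty_iff)
  have r: "r i = Min C" if "C \<in> \<pi>" "i \<in> C" for C i
    unfolding r_def using that disj by (intro arg_cong[of _ _ Min] the_equality) auto
  have sub: "C \<subseteq> {1..n}" if "C \<in> \<pi>" for C
    using that \<pi> by (auto simp: partition_on_def)
  have fin: "finite C" if "C \<in> \<pi>" for C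
    using sub[OF that] finite_subset by blast
  have mem: "Min C \<in> C" if "C \<in> \<pi>" for C
    using that \<pi> fin[OF that] by (auto simp: partition_on_def intro!: Min_in)
  have ex: "\<exists>C\<in>\<pi>. i \<in> C" if "i \<in> {1..n}" for i
    using that \<pi> by (auto simp: partition_on_def)
  have "is_rep_map {1..n} r"
    unfolding is_rep_map_def
  proof
    fix i assume "i \<in> {1..n}"
    then obtain C where C: "C \<in> \<pi>" "i \<in> C" using ex by blast
    show "r i \<in> {1..n} \<and> r i \<le> i \<and> r (r i) = r i"
      using r[OF C] r[OF C(1) mem[OF C(1)]] mem[OF C(1)] sub[OF C(1)] fin[OF C(1)] C(2)
      by auto
  qed
  moreover have "Min ` \<pi> = {i \<in> {1..n}. r i = i}"
  proof (intro equalityI subsetI)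
    fix i assume "i \<in> Min ` \<pi>"
    then obtain C where C: "C \<in> \<pi>" "i = Min C" by blast
    then show "i \<in> {i \<in> {1..n}. r i = i}"
      using mem[OF C(1)] sub[OF C(1)] r[OF C(1) mem[OF C(1)]] by blast
  next
    fix i assume "i \<in> {i \<in> {1..n}. r i = i}"
    then obtain C where "C \<in> \<pi>" "i \<in> C" "r i = i" using ex by blast
    then show "i \<in> Min ` \<pi>" using r by (metis imageI)
  qed
  moreover have "inj_on Min \<pi>"
    using mem disj by (metis inj_onI)
  ultimately have "r \<in> rep_maps n K"
    using card by (simp add: rep_maps_def flip: card_image)
  moreover have "x = map_vec n r" unfolding x by (rule char_vec_eq_map_vec[OF \<pi> r])
  ultimately show "x \<in> map_vec n ` rep_maps n K" by blast
next
  fix x assume "x \<in> map_vec n ` rep_maps n K"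
  then obtain r where x: "x = map_vec n r" and r: "is_rep_map {1..n} r"
    and card: "card {i \<in> {1..n}. r i = i} = K" by (auto simp: rep_maps_def)
  define cl where "cl p = {i \<in> {1..n}. r i = p}" for p
  define \<pi> where "\<pi> = cl ` {i \<in> {1..n}. r i = i}"
  have \<pi>: "partition_on {1..n} \<pi>"
    using r by (auto simp: partition_on_def disjoint_def \<pi>_def cl_def is_rep_map_def)
  have Min: "Min (cl p) = p" if "p \<in> {1..n}" "r p = p" for p
    using that r by (intro Min_eqI) (auto simp: cl_def is_rep_map_def)
  have "inj_on cl {i \<in> {1..n}. r i = i}"
    by (rule inj_on_inverseI[of _ Min]) (use Min in auto)
  then have "card \<pi> = K" using card by (simp add: \<pi>_def card_image)
  moreover have "char_vec n \<pi> = map_vec n r"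
  proof (rule char_vec_eq_map_vec[OF \<pi>])
    fix C i assume "C \<in> \<pi>" "i \<in> C"
    then obtain p where "p \<in> {1..n}" "r p = p" "C = cl p" by (auto simp: \<pi>_def)
    with \<open>i \<in> C\<close> Min show "r i = Min C" by (simp add: cl_def)
  qed
  ultimately show "x \<in> char_vec n ` {\<pi>. k_partition n K \<pi>}"
    using \<pi> x by (force simp: k_partition_def)
qed

lemma partition_polytope_eq: "partition_polytope n K = convex hull (map_vec n ` rep_maps n K)"
  by (simp add: partition_polytope_def char_vec_image_eq_map_vec_image)

text \<open>Vertices outside \<open>X\<close> become singletons until there are \<open>K\<close> clusters; the rest joins vertex 1.\<close>

lemma rep_map_extend:
  assumes X: "X \<subseteq> {1..n}" "1 \<in> X" and h: "is_rep_map X h"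
    and K: "card {i \<in> X. h i = i} \<le> K" "K + card X \<le> n + card {i \<in> X. h i = i}"
  obtains r where "r \<in> rep_maps n K" "\<And>i. i \<in> X \<Longrightarrow> r i = h i"
    "\<And>i. i \<in> {1..n} - X \<Longrightarrow> r i \<in> {1, i}"
proof -
  have "finite X" using X finite_subset by blast
  have "h 1 \<in> {1..n} \<and> h 1 \<le> 1" using h X unfolding is_rep_map_def by blast
  then have "h 1 = 1" by simp
  let ?m = "card {i \<in> X. h i = i}"
  \<comment> \<open>The first bound makes the natural subtraction exact; the second leaves enough
    vertices outside \<open>X\<close> for the missing representatives.\<close>
  have "K - ?m \<le> card ({1..n} - X)"
    using K X \<open>finite X\<close> by (simp add: card_Diff_subset)
  then obtain S where S: "S \<subseteq> {1..n} - X" "card S = K - ?m" "finite S"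
    by (rule obtain_subset_with_card_n)
  define r where "r i = (if i \<in> X then h i else if i \<in> S then i else 1)" for i
  have "is_rep_map {1..n} r"
    using h X S \<open>h 1 = 1\<close> unfolding is_rep_map_def r_def by auto
  moreover have "{i \<in> {1..n}. r i = i} = {i \<in> X. h i = i} \<union> S"
    using X S by (auto simp: r_def split: if_splits)
  moreover have "card ({i \<in> X. h i = i} \<union> S) = K"
    using K S \<open>finite X\<close> by (subst card_Un_disjoint) auto
  ultimately have "r \<in> rep_maps n K" by (simp add: rep_maps_def)
  then show ?thesis by (rule that) (auto simp: r_def)
qed

section \<open>Coordinates and the paw inequality on representative maps\<close>

lemma lookup_map_vec:
  "Poly_Mapping.lookup (map_vec n r) k = (if k \<in> coords n then map_coord r k else 0)"
  by (simp add: map_vec_def lookup_sum lookup_single when_def finite_coords)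

lemma edge_var_map_vec:
  assumes "i \<in> {1..n}" "j \<in> {1..n}" "i \<noteq> j"
  shows "edge_var (map_vec n r) i j = of_bool (r i = r j)"
proof -
  have "Edge {i, j} \<in> coords n" using assms by (auto simp: coords_def)
  then show ?thesis by (auto simp: lookup_map_vec)
qed

lemma lookup_Rep_map_vec:
  "Poly_Mapping.lookup (map_vec n r) (Rep u) = of_bool (u \<in> {4..n} \<and> r u = u)"
  by (auto simp: lookup_map_vec coords_def)

text \<open>There are \<open>K\<close> representatives; vertex 1 always is one, and vertex 2 is one
  exactly when it is not together with 1. This is the relation that eliminates
  \<open>x_3\<close>.\<close>

lemma sum_fixed_points:
  assumes r: "r \<in> rep_maps n K" and n: "3 \<le> n"
  shows "(\<Sum>i=4..n. of_bool (r i = i)) =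
    real K - 2 + of_bool (r 1 = r 2) - of_bool (r 3 = 3)"
proof -
  have iv: "{1..n} = {1, 2, 3} \<union> {4..n}" using n by auto
  have r1: "r 1 = 1" and r2: "r 2 = 1 \<or> r 2 = 2"
    using rep_maps_1[OF r] rep_maps_2[OF r] n by auto
  have "real K = (\<Sum>i\<in>{1..n}. of_bool (r i = i))"
    using r by (subst sum_of_bool_eq) (auto simp: rep_maps_def intro!: arg_cong[of _ _ card])
  also have "\<dots> = of_bool (r 1 = 1) + of_bool (r 2 = 2) + of_bool (r 3 = 3)
      + (\<Sum>i=4..n. of_bool (r i = i))"
    unfolding iv by (subst sum.union_disjoint) auto
  finally show ?thesis using r1 r2 by (elim disjE) simp_all
qed

text \<open>The left-hand side for \<open>b = 3\<close> with \<open>x_3\<close> still present, so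
  that tightness reads \<open>paw = 2\<close> whatever \<open>K\<close> is.\<close>

definition paw :: "nat \<Rightarrow> nat \<Rightarrow> nat \<Rightarrow> (nat \<Rightarrow> nat) \<Rightarrow> real" where
  "paw a c d r = of_bool (r a = r 3) + of_bool (r 3 = r c) - of_bool (r a = r c)
    + of_bool (r c = r d) + of_bool (r 3 = 3) + of_bool (r c = c)"

lemma rep_var_map_vec:
  assumes r: "r \<in> rep_maps n K" and n: "3 \<le> n" and u: "u \<in> {1..n}"
  shows "rep_var n K (map_vec n r) u = of_bool (r u = u)"
proof -
  have r1: "r 1 = 1" and r2: "r 2 = 1 \<or> r 2 = 2"
    using rep_maps_1[OF r] rep_maps_2[OF r] n by auto
  have "(\<Sum>i=4..n. Poly_Mapping.lookup (map_vec n r) (Rep i)) = (\<Sum>i=4..n. of_bool (r i = i))"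
    by (simp add: lookup_Rep_map_vec)
  then show ?thesis
    using u n r1 r2 sum_fixed_points[OF r n]
    by (auto simp: rep_var_def edge_var_map_vec lookup_Rep_map_vec)
qed

text \<open>By \<open>sum_fixed_points\<close>, \<open>x_{1,2}\<close> minus the sum equals
  \<open>x_3 + 2 - K\<close>, which accounts for the shift.\<close>

lemma paw_map_vec:
  assumes r: "r \<in> rep_maps n K" and n: "3 \<le> n"
    and "a \<in> {1..n} - {3}" "c \<in> {1..n} - {3}" "d \<in> {1..n} - {3}"
    and "a \<noteq> c" "a \<noteq> d" "c \<noteq> d"
  shows "edge_var (map_vec n r) a 3 + edge_var (map_vec n r) 3 c - edge_var (map_vec n r) a c
      + edge_var (map_vec n r) c d + rep_var n K (map_vec n r) c + edge_var (map_vec n r) 1 2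
      - (\<Sum>i=4..n. rep_var n K (map_vec n r) i)
    = paw a c d r + 2 - real K"
proof -
  have "(\<Sum>i=4..n. rep_var n K (map_vec n r) i) = (\<Sum>i=4..n. of_bool (r i = i))"
    by (intro sum.cong refl rep_var_map_vec[OF r n]) auto
  with sum_fixed_points[OF r n] show ?thesis
    using assms by (simp add: paw_def edge_var_map_vec rep_var_map_vec[OF r n])
qed

lemma map_coord_doubleton: "map_coord r (Edge {i, j}) = of_bool (r i = r j)"
  by auto

lemma lookup_scaleR:
  "Poly_Mapping.lookup (t *\<^sub>R x) k = t * Poly_Mapping.lookup x k"
    for x :: "'a \<Rightarrow>\<^sub>0 real"
proof -
  have "finite {i. t *\<^sub>R Poly_Mapping.lookup x i \<noteq> 0}"
    by (rule finite_subset[OF _ finite_lookup[of x]]) auto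
  then show ?thesis by (simp add: scaleR_poly_mapping_def Abs_poly_mapping_inverse)
qed

section \<open>Functionals that are constant on the tight partitions\<close>

definition map_value :: "(coord \<Rightarrow> real) \<Rightarrow> nat \<Rightarrow> (nat \<Rightarrow> nat) \<Rightarrow> real" where
  "map_value l n r = (\<Sum>k\<in>coords n. map_coord r k * l k)"

lemma linear_map_vec:
  assumes g: "linear g"
  shows "g (map_vec n r) = map_value (\<lambda>k. g (Poly_Mapping.single k 1)) n r"
proof -
  have eq: "Poly_Mapping.single k x = x *\<^sub>R Poly_Mapping.single k (1::real)" for k :: coord and x
    by (rule poly_mapping_eqI) (simp add: lookup_scaleR lookup_single when_def)
  have gs: "g (Poly_Mapping.single k x) = x * g (Poly_Mapping.single k 1)" for k x
    unfolding eq[of k x] by (simp add: linear_scale[OF g])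
  show ?thesis
    unfolding map_vec_def map_value_def linear_sum[OF g] by (intro sum.cong refl gs)
qed

text \<open>What \<open>u\<close> gains from belonging to the cluster represented by
  \<open>p\<close>.\<close>

definition star :: "(coord \<Rightarrow> real) \<Rightarrow> nat \<Rightarrow> nat \<Rightarrow> (nat \<Rightarrow> nat) \<Rightarrow> nat \<Rightarrow> real" where
  "star l n u r p = (\<Sum>i\<in>{1..n} - {u}. of_bool (r i = p) * l (Edge {u, i}))"

text \<open>Only edges at \<open>u\<close> can change: \<open>u\<close> is a representative neither
  before nor after the move, so all representative coordinates stay.\<close>

lemma map_value_update:
  assumes u: "u \<in> {1..n}" and "r u \<noteq> u" "p \<noteq> u"
  shows "map_value l n (r(u := p)) - map_value l n r = star l n u r p - star l n u r (r u)"
proof -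
  let ?S = "(\<lambda>i. Edge {u, i}) ` ({1..n} - {u})"
  have sub: "?S \<subseteq> coords n" using u by (force simp: coords_def)
  have inj: "inj_on (\<lambda>i. Edge {u, i}) ({1..n} - {u})"
    by (auto simp: inj_on_def doubleton_eq_iff)
  have split: "map_value l n s = (\<Sum>k\<in>coords n - ?S. map_coord s k * l k) + star l n u s (s u)" for s
    unfolding map_value_def star_def sum.subset_diff[OF sub finite_coords] sum.reindex[OF inj]
    by (intro arg_cong2[of _ _ _ _ "(+)"] refl sum.cong) auto
  have "map_coord (r(u := p)) k = map_coord r k" if k: "k \<in> coords n - ?S" for k
  proof -
    consider i j where "k = Edge {i, j}" "i \<in> {1..n}" "j \<in> {1..n}" "i \<noteq> j" | v where "k = Rep v"
      using k by (force simp: coords_def)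
    then show ?thesis
    proof cases
      case 1
      then have "i \<noteq> u" "j \<noteq> u" using k by (auto simp: insert_commute)
      with 1 show ?thesis by auto
    qed (use assms in auto)
  qed
  then have "(\<Sum>k\<in>coords n - ?S. map_coord (r(u := p)) k * l k) = (\<Sum>k\<in>coords n - ?S. map_coord r k * l k)"
    by (intro sum.cong) auto
  moreover have "star l n u (r(u := p)) p = star l n u r p"
    by (auto simp: star_def intro!: sum.cong)
  ultimately show ?thesis using split[of r] split[of "r(u := p)"] by simp
qed

text \<open>By idempotence no vertex is mapped to the non-representative \<open>u\<close>, so
  redirecting \<open>u\<close> disturbs no other vertex.\<close>

lemma rep_maps_update:
  assumes r: "r \<in> rep_maps n K" and u: "u \<in> {1..n}" "r u \<noteq> u"
    and p: "p \<in> {1..n}" "r p = p" "p < u"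
  shows "r(u := p) \<in> rep_maps n K"
proof -
  have "r i \<noteq> u" if "i \<in> {1..n}" for i using rep_mapsD(3)[OF r that] u by auto
  then have "is_rep_map {1..n} (r(u := p))"
    using rep_mapsD[OF r] p u unfolding is_rep_map_def by auto
  moreover have "{i \<in> {1..n}. (r(u := p)) i = i} = {i \<in> {1..n}. r i = i}"
    using u p by auto
  ultimately show ?thesis using r by (simp only: rep_maps_def mem_Collect_eq simp_thms)
qed

lemma is_rep_map_insert:
  assumes "is_rep_map Y h" "u \<notin> Y" "p \<in> Y" "h p = p" "p \<le> u"
  shows "is_rep_map (insert u Y) (h(u := p))"
  using assms unfolding is_rep_map_def by auto

text \<open>The two conditions force \<open>a\<close> and \<open>d\<close> to be 1 and 2 in some
  order. The \<open>l\<close> are the coefficients of an arbitrary functional constant on the tight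
  partitions.\<close>

locale paw_functional =
  fixes n K a c d :: nat and l :: "coord \<Rightarrow> real"
  assumes K: "3 \<le> K" "K + 3 \<le> n" and c: "4 \<le> c" "c \<le> n"
    and ad: "a = 1 \<and> d = 2 \<or> a = 2 \<and> d = 1"
    and const: "\<And>r s. r \<in> rep_maps n K \<Longrightarrow> s \<in> rep_maps n K \<Longrightarrow>
      paw a c d r = 2 \<Longrightarrow> paw a c d s = 2 \<Longrightarrow> map_value l n r = map_value l n s"
begin

abbreviation w :: "nat \<Rightarrow> nat \<Rightarrow> real" where "w i j \<equiv> l (Edge {i, j})"

abbreviation others :: "nat set" where "others \<equiv> {4..n} - {c}"

lemma c_neq: "c \<noteq> 0" "c \<noteq> 1" "c \<noteq> Suc 0" "c \<noteq> 2" "c \<noteq> 3"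
  "0 \<noteq> c" "1 \<noteq> c" "Suc 0 \<noteq> c" "2 \<noteq> c" "3 \<noteq> c"
  using c by auto

section \<open>Edge coefficients at vertices outside \<open>{1, 2, 3, c}\<close>\<close>

lemma paw_cong:
  assumes "\<And>i. i \<in> {1, 2, 3, c} \<Longrightarrow> r i = s i"
  shows "paw a c d r = paw a c d s"
proof -
  have "r a = s a" "r d = s d" "r 3 = s 3" "r c = s c" using ad by (auto intro: assms)
  then show ?thesis by (simp only: paw_def)
qed

text \<open>Both partitions are tight, so \<open>const\<close> equates their values. The targets 1,
  2, 3 are certain to be smaller than \<open>u\<close>.\<close>

lemma star_eq:
  assumes r: "r \<in> rep_maps n K" "paw a c d r = 2" and u: "u \<in> others" "r u \<noteq> u"
    and p: "p \<in> {1, 2, 3}" "r p = p"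
  shows "star l n u r p = star l n u r (r u)"
proof -
  have p': "p \<in> {1..n}" "p < u" and u': "u \<in> {1..n}" using p u K by auto
  have "paw a c d (r(u := p)) = paw a c d r" using u by (intro paw_cong) auto
  then have "map_value l n (r(u := p)) = map_value l n r"
    using r rep_maps_update[OF r(1) u' u(2) p'(1) p(2) p'(2)] by (intro const) auto
  then show ?thesis using map_value_update[of u n r p l] u(2) u' p' by auto
qed

text \<open>Compare moving \<open>u\<close> from \<open>{3, c}\<close> to \<open>{2}\<close> with \<open>v\<close> outside (\<open>y = 1\<close>) and inside (\<open>y = 2\<close>) the target.\<close>

lemma w_others_others:
  assumes u: "u \<in> others" and v: "v \<in> others" and uv: "u \<noteq> v"
  shows "w u v = 0"
proof -
  let ?X = "{1, 2, 3, c, u, v}"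
  have neq: "u \<noteq> 0" "u \<noteq> 1" "u \<noteq> Suc 0" "u \<noteq> 2" "u \<noteq> 3" "u \<noteq> c" "v \<noteq> 0" "v \<noteq> 1" "v \<noteq> Suc 0" "v \<noteq> 2" "v \<noteq> 3" "v \<noteq> c"
    using u v by auto
  note simps = neq neq[symmetric] uv uv[symmetric] c_neq
  have eq: "w u 2 + of_bool (y = 2) * w u v = w u 3 + w u c" if y: "y \<in> {1, 2}" for y :: nat
  proof -
    \<comment> \<open>Tight because \<open>c\<close> lies with the representative 3. Three
      representatives and three other vertices are just what \<open>3 \<le> K\<close> and
      \<open>K + 3 \<le> n\<close> accommodate.\<close>
    define h where "h = id(c := 3, u := 3, v := y)"
    have X: "?X \<subseteq> {1..n}" "1 \<in> ?X" using u v c K by auto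
    have "is_rep_map ?X h" unfolding is_rep_map_def h_def using y u v c by (auto simp: simps)
    moreover have "{i \<in> ?X. h i = i} = {1, 2, 3}"
      using y by (auto simp: h_def simps)
    moreover have "card ?X = 6" by (simp add: simps)
    ultimately obtain r where r: "r \<in> rep_maps n K" "\<And>i. i \<in> ?X \<Longrightarrow> r i = h i"
      "\<And>i. i \<in> {1..n} - ?X \<Longrightarrow> r i \<in> {1, i}"
      using rep_map_extend[OF X, of h K] K by auto
    \<comment> \<open>The extension only creates singletons or enlarges the cluster of 1, so the
      clusters of 2 and 3 are known in full.\<close>
    have st: "star l n u r p = (\<Sum>i\<in>{1, 2, 3, c, v}. of_bool (r i = p) * w u i)" if "p \<in> {2, 3}" for p
    proof -
      have "r i \<noteq> p" if "i \<in> {1..n} - ?X" for i using r(3)[OF that] that \<open>p \<in> {2, 3}\<close> by auto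
      then show ?thesis
        unfolding star_def using X by (intro sum.mono_neutral_right) (auto simp: simps)
    qed
    have v2: "r 1 = 1" "r 2 = 2" "r 3 = 3" "r c = 3" "r u = 3" "r v = y"
      using r(2) by (auto simp: h_def simps)
    have "paw a c d r = 2" using ad v2 by (auto simp: paw_def simps)
    then have "star l n u r 2 = star l n u r 3"
      using star_eq[OF r(1) _ u, of 2] v2 neq by simp
    then show ?thesis using y unfolding st[of 2, simplified] st[of 3, simplified]
      by (auto simp: simps v2 v2(1)[simplified])
  qed
  show ?thesis using eq[of 1] eq[of 2] by simp
qed

lemma star_core:
  assumes "u \<in> others"
  shows "star l n u r p = (\<Sum>i\<in>{1, 2, 3, c}. of_bool (r i = p) * w u i)"
  unfolding star_def using assms c K w_others_others[OF assms]
  by (intro sum.mono_neutral_right) auto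

lemma card_core:
  "card {i \<in> {1, 2, 3, c}. h i = i} =
    of_bool (h 1 = 1) + of_bool (h 2 = 2) + of_bool (h 3 = 3) + of_bool (h c = c)"
proof -
  have "card {i \<in> {1, 2, 3, c}. h i = i} = (\<Sum>i\<in>{1, 2, 3, c}. of_bool (h i = i))"
    by (subst sum_of_bool_eq) (auto intro!: arg_cong[of _ _ card])
  then show ?thesis using c by (simp add: c_neq)
qed

text \<open>Put \<open>u\<close> into the cluster of 1, extend, and compare with \<open>u\<close> in
  the cluster of \<open>p\<close>. With five vertices prescribed, \<open>K + 3 \<le> n\<close>
  demands two representatives and \<open>3 \<le> K\<close> allows three.\<close>

lemma core_star:
  assumes u: "u \<in> others" and h: "is_rep_map {1, 2, 3, c} h" "paw a c d h = 2"
    and m: "card {i \<in> {1, 2, 3, c}. h i = i} \<in> {2, 3}"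
    and p: "p \<in> {1, 2, 3}" "h p = p"
  shows "(\<Sum>i\<in>{1, 2, 3, c}. of_bool (h i = p) * w u i) =
    (\<Sum>i\<in>{1, 2, 3, c}. of_bool (h i = 1) * w u i)"
proof -
  let ?X = "insert u {1, 2, 3, c}" and ?h = "h(u := 1)"
  have neq: "u \<noteq> 0" "u \<noteq> 1" "u \<noteq> Suc 0" "u \<noteq> 2" "u \<noteq> 3" "u \<noteq> c" using u by auto
  have h1: "h 1 = 1" using h(1) c unfolding is_rep_map_def by fastforce
  have X: "?X \<subseteq> {1..n}" "1 \<in> ?X" using u c K by auto
  have rep: "is_rep_map ?X ?h"
    using h(1) h1 neq by (intro is_rep_map_insert) auto
  have "{i \<in> ?X. ?h i = i} = {i \<in> {1, 2, 3, c}. h i = i}"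
    using neq by auto
  moreover have "card ?X = 5" using neq by (simp add: c_neq)
  ultimately have "card {i \<in> ?X. ?h i = i} \<le> K" "K + card ?X \<le> n + card {i \<in> ?X. ?h i = i}"
    using K m by auto
  then obtain r where r: "r \<in> rep_maps n K" "\<And>i. i \<in> ?X \<Longrightarrow> r i = ?h i"
    by (rule rep_map_extend[OF X rep]) blast
  have rh: "r i = h i" if "i \<in> {1, 2, 3, c}" for i using r(2)[of i] that neq by auto
  have "paw a c d r = 2" using paw_cong[of r h] rh h(2) by simp
  moreover have "r u = 1" "r p = p" using r(2)[of u] rh[of p] p by auto
  ultimately have "star l n u r p = star l n u r 1"
    using star_eq[OF r(1) _ u, of p] p neq by simp
  then show ?thesis unfolding star_core[OF u] using rh by simp
qed

lemma w_others_core: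
  assumes u: "u \<in> others" and i: "i \<in> {1, 2, 3, c}"
  shows "w u i = 0"
proof -
  \<comment> \<open>The clusters \<open>{1}\<close>, \<open>{2}\<close>, \<open>{3, c}\<close> and
    then \<open>{1, 2}\<close>, \<open>{3, c}\<close> together force
    \<open>w u 1 = w u 2 = 0\<close> and \<open>w u 3 + w u c = 0\<close>.\<close>
  have 1: "w u 2 = w u 1" "w u 3 + w u c = w u 1"
    using core_star[OF u, of "id(c := 3)" 2] core_star[OF u, of "id(c := 3)" 3] ad c
    unfolding card_core by (auto simp: is_rep_map_def paw_def c_neq)
  have 2: "w u 1 + w u 2 = w u 3 + w u c"
    using core_star[OF u, of "id(2 := 1, c := 3)" 3] ad c
    unfolding card_core by (auto simp: is_rep_map_def paw_def c_neq)
  \<comment> \<open>Placing \<open>c\<close> with \<open>d\<close> separates the last two: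
    \<open>w u 3 = w u a = 0\<close>, hence \<open>w u c = 0\<close>.\<close>
  have 3: "w u d + w u c = w u 3" "w u a = w u 3"
    using core_star[OF u, of "id(c := d)" 2] core_star[OF u, of "id(c := d)" 3] ad c
    unfolding card_core by (auto simp: is_rep_map_def paw_def c_neq)
  show ?thesis using 1 2 3 ad i by auto
qed

section \<open>Reduction to the coefficients on \<open>{1, 2, 3, c}\<close>\<close>

lemma map_value_core:
  "map_value l n r = of_bool (r 1 = r 2) * w 1 2 + of_bool (r 1 = r 3) * w 1 3
     + of_bool (r 2 = r 3) * w 2 3 + of_bool (r 1 = r c) * w 1 c + of_bool (r 2 = r c) * w 2 c
     + of_bool (r 3 = r c) * w 3 c + (\<Sum>i=4..n. of_bool (r i = i) * l (Rep i))"
proof -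
  let ?E = "{Edge {1, 2}, Edge {1, 3}, Edge {2, 3}, Edge {1, c}, Edge {2, c}, Edge {3, c}}"
  have "map_value l n r = (\<Sum>k\<in>?E \<union> Rep ` {4..n}. map_coord r k * l k)"
    unfolding map_value_def
  proof (rule sum.mono_neutral_right[OF finite_coords])
    have "\<exists>i j. Edge {x, y} = Edge {i, j} \<and> i \<in> {1..n} \<and> j \<in> {1..n} \<and> i \<noteq> j"
      if "x \<in> {1..n}" "y \<in> {1..n}" "x \<noteq> y" for x y using that by blast
    then show "?E \<union> Rep ` {4..n} \<subseteq> coords n"
      using c K unfolding coords_def by simp
    show "\<forall>k\<in>coords n - (?E \<union> Rep ` {4..n}). map_coord r k * l k = 0"
    proof
      fix k assume k: "k \<in> coords n - (?E \<union> Rep ` {4..n})"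
      then have "k \<in> coords n" "k \<notin> Rep ` {4..n}" by simp_all
      then obtain i j where ij: "k = Edge {i, j}" "i \<in> {1..n}" "j \<in> {1..n}" "i \<noteq> j"
        unfolding coords_def by blast
      have "i \<in> others \<or> j \<in> others"
      proof (rule ccontr)
        assume "\<not> ?thesis"
        then have "i \<in> {1, 2, 3, c}" "j \<in> {1, 2, 3, c}" using ij by auto
        then have "Edge {i, j} \<in> ?E"
          using \<open>i \<noteq> j\<close> by (elim insertE emptyE) (simp_all add: insert_commute)
        then show False using k ij(1) by blast
      qed
      moreover have w0: "w x y = 0" if "x \<in> others" "y \<in> {1..n}" "x \<noteq> y" for x y
      proof (cases "y \<in> others")
        case False
        then have "y \<in> {1, 2, 3, c}" using that by auto
        then show ?thesis using w_others_core that by blast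
      qed (use w_others_others that in blast)
      ultimately have "l k = 0"
        using ij w0[of i j] w0[of j i] insert_commute[of i j "{}"] by metis
      then show "map_coord r k * l k = 0" by simp
    qed
  qed
  also have "\<dots> = (\<Sum>k\<in>?E. map_coord r k * l k) + (\<Sum>k\<in>Rep ` {4..n}. map_coord r k * l k)"
    by (rule sum.union_disjoint) auto
  also have "(\<Sum>k\<in>Rep ` {4..n}. map_coord r k * l k) = (\<Sum>i=4..n. of_bool (r i = i) * l (Rep i))"
    by (subst sum.reindex) (auto simp: inj_on_def)
  also have "(\<Sum>k\<in>?E. map_coord r k * l k) =
      map_coord r (Edge {1, 2}) * w 1 2 + map_coord r (Edge {1, 3}) * w 1 3
      + map_coord r (Edge {2, 3}) * w 2 3 + map_coord r (Edge {1, c}) * w 1 c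
      + map_coord r (Edge {2, c}) * w 2 c + map_coord r (Edge {3, c}) * w 3 c"
    using c by (simp add: doubleton_eq_iff c_neq del: map_coord.simps)
  finally show ?thesis by (simp only: map_coord_doubleton)
qed

text \<open>Exchange a singleton \<open>u\<close> with a vertex \<open>v\<close> in the cluster of
  1. Tightness persists and edges at \<open>u\<close> and \<open>v\<close> have coefficient 0, so
  the values differ only by \<open>l (Rep v) - l (Rep u)\<close>.\<close>

lemma l_Rep_others:
  assumes u: "u \<in> others" and v: "v \<in> others"
  shows "l (Rep u) = l (Rep v)"
proof (cases "u = v")
  case uv: False
  let ?X = "{1, 2, 3, c, u, v}"
  have neq: "u \<noteq> 0" "u \<noteq> 1" "u \<noteq> Suc 0" "u \<noteq> 2" "u \<noteq> 3" "u \<noteq> c" "v \<noteq> 0" "v \<noteq> 1" "v \<noteq> Suc 0" "v \<noteq> 2" "v \<noteq> 3" "v \<noteq> c"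
    using u v by auto
  note simps = neq neq[symmetric] uv uv[symmetric] c_neq
  \<comment> \<open>Joining 2 to 1 keeps the number of representatives at three although
    \<open>u\<close> is one of them.\<close>
  define h where "h = id(2 := 1, c := 3, v := 1)"
  have X: "?X \<subseteq> {1..n}" "1 \<in> ?X" using u v c K by auto
  have "is_rep_map ?X h" unfolding is_rep_map_def h_def using u v c by (auto simp: simps)
  moreover have "{i \<in> ?X. h i = i} = {1, 3, u}"
    by (auto simp: h_def simps)
  moreover have "card ?X = 6" "card {1, 3, u} = 3" by (simp_all add: simps)
  ultimately obtain r where r: "r \<in> rep_maps n K" "\<And>i. i \<in> ?X \<Longrightarrow> r i = h i"
    "\<And>i. i \<in> {1..n} - ?X \<Longrightarrow> r i \<in> {1, i}"
    using rep_map_extend[OF X, of h K] K by auto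
  have rX: "r 1 = 1" "r 2 = 1" "r 3 = 3" "r c = 3" "r u = u" "r v = 1"
    using r(2) by (auto simp: h_def simps)
  define s where "s = r(u := 1, v := v)"
  have ru: "r i \<noteq> u \<and> r i \<noteq> v" if "i \<in> {1..n} - {u, v}" for i
  proof (cases "i \<in> ?X")
    case True
    then have "i \<in> {1, 2, 3, c}" using that by auto
    then show ?thesis using rX by (auto simp: simps)
  next
    case False
    then show ?thesis using r(3)[of i] that by (auto simp: simps)
  qed
  have "is_rep_map {1..n} s"
    unfolding is_rep_map_def
  proof
    fix i assume i: "i \<in> {1..n}"
    then show "s i \<in> {1..n} \<and> s i \<le> i \<and> s (s i) = s i"
      using rep_mapsD[OF r(1) i] ru[of i] rX by (auto simp: s_def simps)
  qed
  moreover have "card {i \<in> {1..n}. s i = i} = K"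
  proof -
    have "{i \<in> {1..n}. s i = i} = insert v ({i \<in> {1..n}. r i = i} - {u})"
      using rX v by (auto simp: s_def simps)
    also have "card \<dots> = Suc (card ({i \<in> {1..n}. r i = i} - {u}))"
      using rX by (intro card_insert_disjoint) (auto simp: simps)
    also have "\<dots> = card {i \<in> {1..n}. r i = i}"
      using rX u by (intro card_Suc_Diff1) auto
    finally show ?thesis using r(1) by (simp add: rep_maps_def)
  qed
  ultimately have s: "s \<in> rep_maps n K" by (simp add: rep_maps_def)
  have sc: "s i = r i" if "i \<in> {1, 2, 3, c}" for i using that by (auto simp: s_def simps)
  have "paw a c d r = 2" using ad rX by (auto simp: paw_def simps)
  moreover have "paw a c d s = paw a c d r" using sc by (rule paw_cong)
  ultimately have eq: "map_value l n s = map_value l n r" using const[OF s r(1)] by simp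
  have core: "s 1 = r 1" "s 2 = r 2" "s 3 = r 3" "s c = r c" by (auto intro: sc)
  let ?R = "\<lambda>t i. of_bool (t i = i) * l (Rep i)"
  have sums: "sum (?R s) {4..n} = sum (?R r) {4..n}"
    using eq unfolding map_value_core core by (rule add_left_imp_eq)
  have split: "sum f {4..n} = f u + (f v + sum f ({4..n} - {u} - {v}))" for f :: "nat \<Rightarrow> real"
    using u v uv sum.remove[of "{4..n}" u f] sum.remove[of "{4..n} - {u}" v f] by simp
  have rest: "sum (?R s) ({4..n} - {u} - {v}) = sum (?R r) ({4..n} - {u} - {v})"
    by (intro sum.cong) (auto simp: s_def)
  have "s u = 1" "s v = v" by (auto simp: s_def uv)
  then have "?R s u = 0" "?R s v = l (Rep v)" "?R r u = l (Rep u)" "?R r v = 0"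
    using rX neq by simp_all
  then show ?thesis using sums unfolding split[of "?R s"] split[of "?R r"] rest by linarith
qed simp

lemma map_value_eq_paw:
  "\<exists>t s. \<forall>r\<in>rep_maps n K. map_value l n r = t * paw a c d r + s"
proof -
  \<comment> \<open>The common coefficient of the representatives in \<open>others\<close>, read off
    at a vertex that exists because \<open>n \<ge> 6\<close>.\<close>
  define rh where "rh = l (Rep (if c = 4 then 5 else 4))"
  have rh: "l (Rep u) = rh" if "u \<in> others" for u
    unfolding rh_def by (rule l_Rep_others[OF that]) (use K in auto)
  \<comment> \<open>Eliminating the sum of representative variables by
    \<open>sum_fixed_points\<close> makes the value depend only on 1, 2, 3 and \<open>c\<close>, so
    it can be computed before a map is extended.\<close>
  define val where "val r = of_bool (r 1 = r 2) * w 1 2 + of_bool (r 1 = r 3) * w 1 3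
     + of_bool (r 2 = r 3) * w 2 3 + of_bool (r 1 = r c) * w 1 c + of_bool (r 2 = r c) * w 2 c
     + of_bool (r 3 = r c) * w 3 c + of_bool (r c = c) * (l (Rep c) - rh)
     + rh * (real K - 2 + of_bool (r 1 = r 2) - of_bool (r 3 = 3))" for r :: "nat \<Rightarrow> nat"
  have val: "map_value l n r = val r" if r: "r \<in> rep_maps n K" for r
  proof -
    have "(\<Sum>i=4..n. of_bool (r i = i) * l (Rep i)) =
        (\<Sum>i=4..n. rh * of_bool (r i = i) + (if i = c then of_bool (r c = c) * (l (Rep c) - rh) else 0))"
      by (intro sum.cong) (auto simp: rh)
    also have "\<dots> = rh * (\<Sum>i=4..n. of_bool (r i = i)) + of_bool (r c = c) * (l (Rep c) - rh)"
      using c by (simp add: sum.distrib sum_distrib_left)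
    finally show ?thesis
      using sum_fixed_points[OF r] K by (simp add: map_value_core val_def)
  qed
  \<comment> \<open>With four vertices prescribed one representative is enough, which admits even
    the single cluster \<open>{1, 2, 3, c}\<close>.\<close>
  have ex: "\<exists>r\<in>rep_maps n K. paw a c d r = 2 \<and> val r = val h"
    if h: "is_rep_map {1, 2, 3, c} h" "paw a c d h = 2"
      and m: "card {i \<in> {1, 2, 3, c}. h i = i} \<in> {1, 2, 3}" for h
  proof -
    have X: "{1, 2, 3, c} \<subseteq> {1..n}" "1 \<in> {1, 2, 3, c}" using c K by auto
    have "card {1, 2, 3, c} = 4" by (simp add: c_neq)
    then have "card {i \<in> {1, 2, 3, c}. h i = i} \<le> K"
      "K + card {1, 2, 3, c} \<le> n + card {i \<in> {1, 2, 3, c}. h i = i}"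
      using K m by auto
    then obtain r where r: "r \<in> rep_maps n K" "\<And>i. i \<in> {1, 2, 3, c} \<Longrightarrow> r i = h i"
      by (rule rep_map_extend[OF X h(1)]) blast
    then have "paw a c d r = 2" "val r = val h"
      using paw_cong[of r h] h(2) by (auto simp: val_def)
    with r(1) show ?thesis by blast
  qed
  have eq: "val h = val h'"
    if "is_rep_map {1, 2, 3, c} h" "paw a c d h = 2" "card {i \<in> {1, 2, 3, c}. h i = i} \<in> {1, 2, 3}"
      "is_rep_map {1, 2, 3, c} h'" "paw a c d h' = 2" "card {i \<in> {1, 2, 3, c}. h' i = i} \<in> {1, 2, 3}"
    for h h'
    using ex[OF that(1-3)] ex[OF that(4-6)] const val by metis
  define h0 where "h0 = id(c := 3)"
  have h0: "is_rep_map {1, 2, 3, c} h0" "paw a c d h0 = 2" "card {i \<in> {1, 2, 3, c}. h0 i = i} \<in> {1, 2, 3}"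
    using ad c unfolding card_core by (auto simp: h0_def is_rep_map_def paw_def c_neq)
  note eq0 = eq[OF _ _ _ h0]
  have e: "\<forall>h\<in>{id(c := d), id(3 := a), id(2 := 1), id(2 := 1, c := 3), id(3 := a, c := d),
      id(3 := d, c := d), id(2 := 1, 3 := 1), id(2 := 1, 3 := 1, c := 1)}. val h = val h0"
  proof
    fix h
    assume h: "h \<in> {id(c := d), id(3 := a), id(2 := 1), id(2 := 1, c := 3), id(3 := a, c := d),
      id(3 := d, c := d), id(2 := 1, 3 := 1), id(2 := 1, 3 := 1, c := 1)}"
    show "val h = val h0"
    proof (rule eq0)
      show "is_rep_map {1, 2, 3, c} h"
        using h ad c by (elim insertE emptyE disjE) (simp_all add: is_rep_map_def c_neq)
      show "paw a c d h = 2"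
        using h ad c by (elim insertE emptyE disjE) (simp_all add: paw_def c_neq)
      show "card {i \<in> {1, 2, 3, c}. h i = i} \<in> {1, 2, 3}"
        unfolding card_core using h ad c by (elim insertE emptyE disjE) (simp_all add: c_neq)
    qed
  qed
  define t where "t = w 3 c"
  \<comment> \<open>\<open>id(c := d)\<close> gives \<open>w c d = t\<close>. The partitions into
    two pairs give \<open>w a d = w a 3 = - rh\<close>; a singleton \<open>c\<close> beside one pair
    gives \<open>l (Rep c) = rh + t\<close>. Then \<open>{1, 2, 3}\<close> yields
    \<open>w d 3 = 0\<close>, \<open>{d, 3, c}\<close> yields \<open>rh = - t\<close>, and the
    single cluster yields \<open>w a c = - t\<close>.\<close>
  have wt: "w a d = t" "w a 3 = t" "w c d = t" "w d 3 = 0" "w a c = - t" "rh = - t" "l (Rep c) = 0"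
    using e ad unfolding val_def h0_def t_def
    by (auto simp: c_neq insert_commute algebra_simps)
  \<comment> \<open>The terms for \<open>r 1 = r 2\<close> from \<open>w 1 2 = t\<close> and
    \<open>rh = - t\<close> cancel; the rest is \<open>t * paw\<close> up to a constant.\<close>
  have "map_value l n r = t * paw a c d r + (- t) * (real K - 2)" if r: "r \<in> rep_maps n K" for r
    using ad
  proof (elim disjE conjE)
    assume ad': "a = 1" "d = 2"
    have "w 1 2 = t" "w 1 3 = t" "w 2 3 = 0" "w 1 c = - t" "w 2 c = t" "w 3 c = t"
      using wt unfolding ad' by (simp_all only: insert_commute t_def)
    then show ?thesis
      unfolding val[OF r] val_def paw_def wt ad' eq_commute[of "r c" "r 2"]
      by (simp only: algebra_simps)
  next
    assume ad': "a = 2" "d = 1"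
    have "w 1 2 = t" "w 1 3 = 0" "w 2 3 = t" "w 1 c = t" "w 2 c = - t" "w 3 c = t"
      using wt unfolding ad' by (simp_all only: insert_commute t_def)
    then show ?thesis
      unfolding val[OF r] val_def paw_def wt ad' eq_commute[of "r c" "r 1"]
      by (simp only: algebra_simps)
  qed
  then show ?thesis by blast
qed

end

text \<open>Three fixed and three non-fixed vertices always fit since \<open>3 \<le> K\<close> and
  \<open>K + 3 \<le> n\<close>. The entries of the bounding triples may coincide.\<close>

lemma rep_map_extend_paw:
  assumes K: "3 \<le> K" "K + 3 \<le> n" and X: "X \<subseteq> {1..n}" "1 \<in> X" "{a, 3, c, d} \<subseteq> X"
    and h: "is_rep_map X h"
    and fixp: "{i \<in> X. h i = i} \<subseteq> {p, q, s}" and nonfix: "{i \<in> X. h i \<noteq> i} \<subseteq> {p', q', s'}"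
  obtains r where "r \<in> rep_maps n K" "paw a c d r = paw a c d h"
proof -
  have fin: "finite X" using X finite_subset by blast
  have card3: "card {x, y, z} \<le> 3" for x y z :: nat by (simp add: card_insert_if)
  have "card {i \<in> X. h i = i} \<le> K"
    using card_mono[OF _ fixp] card3[of p q s] K by simp
  moreover have "card X = card {i \<in> X. h i = i} + card {i \<in> X. h i \<noteq> i}"
    using fin by (subst card_Un_disjoint[symmetric]) (auto intro: arg_cong[of _ _ card])
  then have "K + card X \<le> n + card {i \<in> X. h i = i}"
    using card_mono[OF _ nonfix] card3[of p' q' s'] K by simp
  ultimately obtain r where r: "r \<in> rep_maps n K" "\<And>i. i \<in> X \<Longrightarrow> r i = h i"
    by (rule rep_map_extend[OF X(1,2) h]) blast
  have "r a = h a" "r 3 = h 3" "r c = h c" "r d = h d" using r(2) X(3) by auto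
  then have "paw a c d r = paw a c d h" by (simp only: paw_def)
  with r(1) that show ?thesis by blast
qed

section \<open>Necessity and sufficiency of the conditions\<close>

text \<open>In every case a partition separates \<open>a\<close> from \<open>c\<close> and makes
  three positive terms equal to 1, so the inequality is not even valid.\<close>

lemma paw_violated:
  assumes K: "3 \<le> K" "K + 3 \<le> n"
    and mem: "a \<in> {1..n} - {3}" "c \<in> {1..n} - {3}" "d \<in> {1..n} - {3}"
    and neq: "a \<noteq> c" "a \<noteq> d" "c \<noteq> d"
    and cond: "\<not> ((d < 3 \<and> 3 < c) \<and> a < 3)"
  obtains r where "r \<in> rep_maps n K" "2 < paw a c d r"
proof -
  note violated = that
  have ext: thesis
    if "X \<subseteq> {1..n}" "1 \<in> X" "{a, 3, c, d} \<subseteq> X" "is_rep_map X h" "2 < paw a c d h"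
      "{i \<in> X. h i = i} \<subseteq> {p, q, s}" "{i \<in> X. h i \<noteq> i} \<subseteq> {p', q', s'}"
    for X h p q s p' q' s'
    by (rule rep_map_extend_paw[OF K that(1-4,6,7)]) (use that(5) in \<open>simp add: violated\<close>)
  have n0: "a \<noteq> 0" "c \<noteq> 0" "d \<noteq> 0" "a \<noteq> 3" "c \<noteq> 3" "d \<noteq> 3" "3 \<noteq> a" "3 \<noteq> c" "3 \<noteq> d"
    "c \<noteq> a" "d \<noteq> a" "d \<noteq> c"
    using mem neq by auto
  have pos: "Suc 0 \<le> a" "Suc 0 \<le> c" "Suc 0 \<le> d" using mem by auto
  have small: "x = 1 \<or> x = 2 \<or> 4 \<le> x" if "x \<noteq> 0" "x \<noteq> 3" for x :: nat
    using that by arith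
  \<comment> \<open>Three cases with \<open>c < 3\<close> and three with \<open>c \<ge> 4\<close>;
    what remains is exactly \<open>a, d < 3 < c\<close>.\<close>
  have "c = 1 \<or> c = 2 \<and> 4 \<le> d \<or> c = 2 \<and> d = 1 \<and> 4 \<le> a \<or> 4 \<le> c \<and> c < d
    \<or> 4 \<le> c \<and> 4 \<le> a \<and> d < c \<or> 4 \<le> c \<and> a < 3 \<and> 3 < d \<and> d < c"
    using small[OF n0(1,4)] small[OF n0(2,5)] small[OF n0(3,6)] neq cond by (elim disjE) auto
  then consider "c = 1" | "c = 2" "4 \<le> d" | "c = 2" "d = 1" "4 \<le> a" | "4 \<le> c" "c < d"
    | "4 \<le> c" "4 \<le> a" "d < c" | "4 \<le> c" "a < 3" "3 < d" "d < c"
    by blast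
  then show thesis
  proof cases
    case 1
    \<comment> \<open>Clusters \<open>{1, 3, d}\<close> and \<open>{a}\<close>.\<close>
    show thesis
    proof (rule ext[of "{1, 3, d, a}" "id(3 := 1, d := 1)" 1 a a 3 d d])
      show "is_rep_map {1, 3, d, a} (id(3 := 1, d := 1))"
        using 1 n0 neq by (auto simp: is_rep_map_def)
      show "2 < paw a c d (id(3 := 1, d := 1))"
        using 1 n0 neq by (simp add: paw_def)
      show "{1, 3, d, a} \<subseteq> {1..n}" using 1 mem K by auto
      show "1 \<in> {1, 3, d, a}" by simp
      show "{a, 3, c, d} \<subseteq> {1, 3, d, a}" using 1 by simp
      show "{i \<in> {1, 3, d, a}. (id(3 := 1, d := 1)) i = i} \<subseteq> {1, a, a}" using 1 n0 by auto
      show "{i \<in> {1, 3, d, a}. (id(3 := 1, d := 1)) i \<noteq> i} \<subseteq> {3, d, d}" by auto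
    qed
  next
    case 2
    \<comment> \<open>Clusters \<open>{1, a}\<close> and \<open>{2, 3, d}\<close>;
      \<open>d \<ge> 4\<close> keeps \<open>c = 2\<close> a representative.\<close>
    show thesis
    proof (rule ext[of "{1, 2, 3, d, a}" "id(3 := 2, d := 2, a := 1)" 1 2 2 3 d a])
      show "is_rep_map {1, 2, 3, d, a} (id(3 := 2, d := 2, a := 1))"
        using 2 n0 neq by (auto simp: is_rep_map_def)
      show "2 < paw a c d (id(3 := 2, d := 2, a := 1))"
        using 2 n0 neq by (simp add: paw_def)
      show "{1, 2, 3, d, a} \<subseteq> {1..n}" using 2 mem K by auto
      show "1 \<in> {1, 2, 3, d, a}" by simp
      show "{a, 3, c, d} \<subseteq> {1, 2, 3, d, a}" using 2 by simp
      show "{i \<in> {1, 2, 3, d, a}. (id(3 := 2, d := 2, a := 1)) i = i} \<subseteq> {1, 2, 2}" using 2 n0 by auto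
      show "{i \<in> {1, 2, 3, d, a}. (id(3 := 2, d := 2, a := 1)) i \<noteq> i} \<subseteq> {3, d, a}" by auto
    qed
  next
    case 3
    \<comment> \<open>Clusters \<open>{1, 2}\<close> and \<open>{3, a}\<close>;
      \<open>a \<ge> 4\<close> keeps 3 a representative.\<close>
    show thesis
    proof (rule ext[of "{1, 2, 3, a}" "id(2 := 1, a := 3)" 1 3 3 2 a a])
      show "is_rep_map {1, 2, 3, a} (id(2 := 1, a := 3))"
        using 3 n0 neq by (auto simp: is_rep_map_def)
      show "2 < paw a c d (id(2 := 1, a := 3))"
        using 3 n0 neq by (simp add: paw_def)
      show "{1, 2, 3, a} \<subseteq> {1..n}" using 3 mem K by auto
      show "1 \<in> {1, 2, 3, a}" by simp
      show "{a, 3, c, d} \<subseteq> {1, 2, 3, a}" using 3 by simp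
      show "{i \<in> {1, 2, 3, a}. (id(2 := 1, a := 3)) i = i} \<subseteq> {1, 3, 3}" using 3 n0 by auto
      show "{i \<in> {1, 2, 3, a}. (id(2 := 1, a := 3)) i \<noteq> i} \<subseteq> {2, a, a}" by auto
    qed
  next
    case 4
    \<comment> \<open>Clusters \<open>{1, a}\<close>, \<open>{3}\<close>, \<open>{c, d}\<close>;
      \<open>c < d\<close> makes \<open>c\<close> a representative.\<close>
    show thesis
    proof (rule ext[of "{1, 3, c, d, a}" "id(d := c, a := 1)" 1 3 c d a a])
      show "is_rep_map {1, 3, c, d, a} (id(d := c, a := 1))"
        using 4 by (auto simp: is_rep_map_def n0 neq pos)
      show "2 < paw a c d (id(d := c, a := 1))"
        using 4 by (simp add: paw_def n0 neq)
      show "{1, 3, c, d, a} \<subseteq> {1..n}" using 4 mem K by auto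
      show "1 \<in> {1, 3, c, d, a}" by simp
      show "{a, 3, c, d} \<subseteq> {1, 3, c, d, a}" using 4 by simp
      show "{i \<in> {1, 3, c, d, a}. (id(d := c, a := 1)) i = i} \<subseteq> {1, 3, c}" using 4 by (auto simp: n0)
      show "{i \<in> {1, 3, c, d, a}. (id(d := c, a := 1)) i \<noteq> i} \<subseteq> {d, a, a}" by auto
    qed
  next
    case 5
    \<comment> \<open>Clusters \<open>{3, a}\<close> and \<open>{d, c}\<close>, with 1 alone unless
      it is \<open>d\<close>.\<close>
    show thesis
    proof (rule ext[of "{1, 3, a, c, d}" "id(a := 3, c := d)" 1 3 d a c c])
      show "is_rep_map {1, 3, a, c, d} (id(a := 3, c := d))"
        using 5 by (auto simp: is_rep_map_def n0 neq pos)
      show "2 < paw a c d (id(a := 3, c := d))"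
        using 5 by (simp add: paw_def n0 neq)
      show "{1, 3, a, c, d} \<subseteq> {1..n}" using 5 mem K by auto
      show "1 \<in> {1, 3, a, c, d}" by simp
      show "{a, 3, c, d} \<subseteq> {1, 3, a, c, d}" using 5 by simp
      show "{i \<in> {1, 3, a, c, d}. (id(a := 3, c := d)) i = i} \<subseteq> {1, 3, d}" using 5 by (auto simp: n0)
      show "{i \<in> {1, 3, a, c, d}. (id(a := 3, c := d)) i \<noteq> i} \<subseteq> {a, c, c}" by auto
    qed
  next
    case 6
    \<comment> \<open>Cluster \<open>{3, c, d}\<close>, with 1 and \<open>a\<close> outside
      it.\<close>
    show thesis
    proof (rule ext[of "{1, 3, c, d, a}" "id(c := 3, d := 3)" 1 3 a c d d])
      show "is_rep_map {1, 3, c, d, a} (id(c := 3, d := 3))"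
        using 6 by (auto simp: is_rep_map_def n0 neq pos)
      show "2 < paw a c d (id(c := 3, d := 3))"
        using 6 by (simp add: paw_def n0 neq)
      show "{1, 3, c, d, a} \<subseteq> {1..n}" using 6 mem K by auto
      show "1 \<in> {1, 3, c, d, a}" by simp
      show "{a, 3, c, d} \<subseteq> {1, 3, c, d, a}" using 6 by simp
      show "{i \<in> {1, 3, c, d, a}. (id(c := 3, d := 3)) i = i} \<subseteq> {1, 3, a}" using 6 by (auto simp: n0)
      show "{i \<in> {1, 3, c, d, a}. (id(c := 3, d := 3)) i \<noteq> i} \<subseteq> {c, d, d}" by auto
    qed
  qed
qed

text \<open>The vertex 3 cannot both be a representative and lie with \<open>a < 3\<close>. If
  \<open>c\<close> is a representative, its edges to 1, 2, 3 vanish. Otherwise, if 3 is a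
  representative, \<open>c\<close> is not with both 3 and \<open>d\<close>; if 3 lies with
  \<open>a\<close>, the terms for \<open>3, c\<close> and \<open>a, c\<close> cancel.\<close>

lemma paw_le_2:
  assumes r: "r \<in> rep_maps n K" and n: "3 \<le> n"
    and ad: "a = 1 \<and> d = 2 \<or> a = 2 \<and> d = 1" and c: "4 \<le> c"
  shows "paw a c d r \<le> 2"
proof -
  have r12: "r 1 = 1" "r 2 = 1 \<or> r 2 = 2" using rep_maps_1[OF r] rep_maps_2[OF r] n by auto
  have "r 3 \<in> {1..n}" "r 3 \<le> 3" "r (r 3) = r 3" using rep_mapsD[OF r, of 3] n by auto
  moreover from this have "r 3 = 1 \<or> r 3 = 2 \<or> r 3 = 3" by (auto simp: le_Suc_eq numeral_3_eq_3)
  ultimately have r3: "r 3 = 1 \<or> r 3 = 2 \<and> r 2 = 2 \<or> r 3 = 3" by metis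
  show ?thesis
    using ad
  proof (elim disjE conjE)
    assume ad': "a = 1" "d = 2"
    show ?thesis
      unfolding paw_def ad' eq_commute[of "r 3" "r c"] eq_commute[of "r 1" "r c"]
      using r12 r3 c by (elim disjE conjE) (simp_all add: of_bool_def)
  next
    assume ad': "a = 2" "d = 1"
    show ?thesis
      unfolding paw_def ad' eq_commute[of "r 3" "r c"] eq_commute[of "r 2" "r c"]
      using r12 r3 c by (elim disjE conjE) (simp_all add: of_bool_def)
  qed
qed

theorem theorem9p4:
  fixes n K a b c d :: nat
  assumes "K \<in> {3..n - 3}" and "b = 3"
    and "a \<in> {1..n} - {3}" and "c \<in> {1..n} - {3}" and "d \<in> {1..n} - {3}"
    and "a \<noteq> c" and "a \<noteq> d" and "c \<noteq> d"
  shows "facet_defining (partition_polytope n K)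
           (\<lambda>x. edge_var x a b + edge_var x b c - edge_var x a c + edge_var x c d
                + rep_var n K x c + edge_var x 1 2 - (\<Sum>i=4..n. rep_var n K x i))
           (4 - real K)
         \<longleftrightarrow> (d < 3 \<and> 3 < c) \<and> a < 3"
proof -
  define f where "f x = edge_var x a b + edge_var x b c - edge_var x a c + edge_var x c d
      + rep_var n K x c + edge_var x 1 2 - (\<Sum>i=4..n. rep_var n K x i)" for x
  have K: "3 \<le> K" "K + 3 \<le> n" and n: "3 \<le> n" using assms(1) by auto
  have f_map_vec: "f (map_vec n r) = paw a c d r + 2 - real K" if "r \<in> rep_maps n K" for r
    unfolding f_def \<open>b = 3\<close> using assms by (intro paw_map_vec[OF that n]) auto
  let ?V = "map_vec n ` rep_maps n K"
  have "facet_defining (partition_polytope n K) f (4 - real K) \<longleftrightarrow> (d < 3 \<and> 3 < c) \<and> a < 3"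
  proof
    assume facet: "facet_defining (partition_polytope n K) f (4 - real K)"
    show "(d < 3 \<and> 3 < c) \<and> a < 3"
    proof (rule ccontr)
      assume "\<not> ((d < 3 \<and> 3 < c) \<and> a < 3)"
      then obtain r where r: "r \<in> rep_maps n K" "paw a c d r > 2"
        using paw_violated[OF K assms(3-8)] by blast
      have "map_vec n r \<in> partition_polytope n K"
        unfolding partition_polytope_eq using r(1) by (intro hull_inc imageI)
      then have "f (map_vec n r) \<le> 4 - real K" using facet by (simp add: facet_defining_def)
      with f_map_vec[OF r(1)] r(2) show False by simp
    qed
  next
    assume cond: "(d < 3 \<and> 3 < c) \<and> a < 3"
    then have ad: "a = 1 \<and> d = 2 \<or> a = 2 \<and> d = 1" and c: "4 \<le> c" "c \<le> n"
      using assms by auto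
    \<comment> \<open>Since \<open>c \<ge> 4\<close>, only genuine coordinates occur, so
      \<open>f\<close> is linear and not merely affine.\<close>
    have "f = (\<lambda>x. edge_var x a b + edge_var x b c - edge_var x a c + edge_var x c d
        + Poly_Mapping.lookup x (Rep c) + edge_var x 1 2
        - (\<Sum>i=4..n. Poly_Mapping.lookup x (Rep i)))"
      using c by (auto simp: f_def rep_var_def fun_eq_iff intro!: sum.cong)
    then have lin: "linear f"
      by (intro linearI)
        (simp_all add: lookup_add lookup_scaleR sum.distrib flip: sum_distrib_left, simp_all add: algebra_simps)
    \<comment> \<open>A tight partition, and below one that is not tight because \<open>c\<close>
      lies with \<open>a\<close>; the face is thus non-empty and proper.\<close>
    obtain r0 where r0: "r0 \<in> rep_maps n K" "paw a c d r0 = paw a c d (id(c := 3))"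
      by (rule rep_map_extend_paw[OF K, of "{1, 2, 3, c}" a c d "id(c := 3)" 1 2 3 c c c])
        (use ad c K in \<open>auto simp: is_rep_map_def\<close>)
    have paw_r0: "paw a c d r0 = 2" using r0(2) ad c by (auto simp: paw_def)
    obtain r1 where r1: "r1 \<in> rep_maps n K" "paw a c d r1 = paw a c d (id(c := a))"
      by (rule rep_map_extend_paw[OF K, of "{1, 2, 3, c}" a c d "id(c := a)" 1 2 3 c c c])
        (use ad c K in \<open>auto simp: is_rep_map_def\<close>)
    have paw_r1: "paw a c d r1 = 0" using r1(2) ad c by (auto simp: paw_def)
    show "facet_defining (partition_polytope n K) f (4 - real K)"
      unfolding partition_polytope_eq
    proof (rule facet_defining_convex_hullI[OF _ lin])
      \<comment> \<open>Finiteness is taken from the partitions, as maps in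
        \<open>rep_maps n K\<close> are arbitrary outside \<open>{1..n}\<close>.\<close>
      have "finite {\<pi>. k_partition n K \<pi>}"
        by (rule finite_subset[OF _ finitely_many_partition_on[of "{1..n}"]]) (auto simp: k_partition_def)
      then show "finite ?V" by (simp flip: char_vec_image_eq_map_vec_image)
      show "f v \<le> 4 - real K" if "v \<in> ?V" for v
        using that f_map_vec paw_le_2[OF _ n ad c(1)] by fastforce
      show "map_vec n r0 \<in> ?V" "f (map_vec n r0) = 4 - real K"
        using r0(1) paw_r0 f_map_vec by auto
      show "map_vec n r1 \<in> ?V" "f (map_vec n r1) \<noteq> 4 - real K"
        using r1(1) paw_r1 f_map_vec by auto
    next
      fix g :: "(coord \<Rightarrow>\<^sub>0 real) \<Rightarrow> real"
      assume g: "linear g"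
        and const: "\<And>x y. x \<in> ?V \<Longrightarrow> y \<in> ?V \<Longrightarrow> f x = 4 - real K \<Longrightarrow> f y = 4 - real K \<Longrightarrow> g x = g y"
      \<comment> \<open>The coefficients of \<open>g\<close> are its values on the unit
        vectors.\<close>
      interpret paw_functional n K a c d "\<lambda>k. g (Poly_Mapping.single k 1)"
      proof
        fix r s assume "r \<in> rep_maps n K" "s \<in> rep_maps n K" "paw a c d r = 2" "paw a c d s = 2"
        then have "g (map_vec n r) = g (map_vec n s)"
          by (intro const) (auto simp: f_map_vec)
        then show "map_value (\<lambda>k. g (Poly_Mapping.single k 1)) n r = map_value (\<lambda>k. g (Poly_Mapping.single k 1)) n s"
          unfolding linear_map_vec[OF g] .
      qed (use K c ad in auto)
      obtain t s where ts: "\<And>r. r \<in> rep_maps n K \<Longrightarrow> g (map_vec n r) = t * paw a c d r + s"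
        using map_value_eq_paw unfolding linear_map_vec[OF g] by blast
      have "g v = t * f v + (s - t * (2 - real K))" if v: "v \<in> ?V" for v
        using v by (auto simp: f_map_vec ts algebra_simps)
      then show "\<exists>t s. \<forall>v\<in>?V. g v = t * f v + s" by blast
    qed
  qed
  then show ?thesis unfolding f_def .
qed

end
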